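(* Let $1\le k\le n$ be integers, let $\mathbf{w}=[w_1,\dots,w_n]$ be positive real weights attached to $n$ items $x_1,\dots,x_n$, and let $\mathrm{RelaxedTopK}$ be a top-$k$ relaxation (as defined in the context). Let $u_1,\dots,u_n$ be independent random variables, each uniform on $(0,1)$, and set $$\hat r_i=-\log(-\log(u_i))+\log(w_i),\qquad i=1,\dots,n,\qquad \hat{\mathbf r}=[\hat r_1,\dots,\hat r_n].$$ For $t>0$ let $\mathbf{a}_t=\mathrm{RelaxedTopK}(\hat{\mathbf r},k,t)$ be the output of the Relaxed Subset Sampling algorithm at temperature $t$. Then, as $t\to 0^+$, the algorithm gives exact samples from the subset distribution $p(\cdot\mid\mathbf{w})$: $\mathbf{a}_t$ converges almost surely to a random $k$-hot vector whose distribution is $p(S\mid\mathbf{w})$.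
   Context: For $1\le j\le n$, $\mathbf e^{j}\in\{0,1\}^n$ denotes the 1-hot (standard basis) vector with a $1$ in position $j$. A $k$-hot vector is a vector $S\in\{0,1\}^n$ with exactly $k$ entries equal to $1$; it represents a subset of size $k$ of the items. A relaxed $k$-hot vector is $\mathbf a=[a_1,\dots,a_n]\in\mathbb R^n$ with $0\le a_i\le 1$ for all $i$ and $\sum_{i=1}^n a_i=k$. Distribution over sequences (weighted sampling without replacement): with $Z=\sum_{i=1}^n w_i$, for a sequence $S_{wrs}=[\mathbf e^{i_1},\dots,\mathbf e^{i_k}]$ with distinct indices $i_1,\dots,i_k$, $$p(S_{wrs}\mid \mathbf w)=\frac{w_{i_1}}{Z}\cdot\frac{w_{i_2}}{Z-w_{i_1}}\cdots\frac{w_{i_k}}{Z-\sum_{j=1}^{k-1}w_{i_j}}.$$ Distribution over subsets: for a $k$-hot vector $S$, $$p(S\mid\mathbf w)=\sum_{S_{wrs}\in\Pi(S)}p(S_{wrs}\mid\mathbf w),$$ where $\Pi(S)$ is the set of all sequences $S_{wrs}=[\mathbf e^{i_1},\dots,\mathbf e^{i_k}]$ of 1-hot vectors with distinct indices such that $\sum_{j=1}^k \mathbf e^{i_j}=S$ (i.e. all orderings of the elements of $S$). For $\mathbf r\in\mathbb R^n$ with pairwise distinct entries, $\mathrm{TopK}(\mathbf r,k)=[\mathbf e^{i_1},\dots,\mathbf e^{i_k}]$, where $r_{i_1}>r_{i_2}>\dots>r_{i_k}$ are the $k$ largest entries of $\mathbf r$ in decreasing order; $\mathrm{TopK}(\mathbf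 r,k)[j]=\mathbf e^{i_j}$. A top-$k$ relaxation $\mathrm{RelaxedTopK}$ is a function that takes $\mathbf r\in\mathbb R^n$, $k$, and a temperature $t>0$, is differentiable in $\mathbf r$, returns a relaxed $k$-hot vector $\mathrm{RelaxedTopK}(\mathbf r,k,t)\in\mathbb R^n$, and satisfies, for every $\mathbf r$ with pairwise distinct entries, $$\mathrm{RelaxedTopK}(\mathbf r,k,t)\to\sum_{j=1}^k\mathrm{TopK}(\mathbf r,k)[j]\quad\text{as } t\to 0^+.$$ The Relaxed Subset Sampling algorithm with input $\mathbf w$, $k$, $t$ draws independent uniform variables $u_1,\dots,u_n$ on $(0,1)$, forms the keys $\hat r_i=-\log(-\log(u_i))+\log(w_i)$, and returns $\mathrm{RelaxedTopK}(\hat{\mathbf r},k,t)$. *)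

theory Defs
  imports "HOL-Probability.Probability"
begin

text \<open>
  The items are the elements of a finite type \<open>'n\<close>, so the number of items is \<open>CARD('n)\<close>.
  A sequence of 1-hot vectors is represented by the list of their (distinct) hot positions.
\<close>

definition one_hot :: "'n::finite \<Rightarrow> real ^ 'n" where
  "one_hot i = axis i 1"

definition k_hot :: "nat \<Rightarrow> real ^ 'n::finite \<Rightarrow> bool" where
  "k_hot k S \<longleftrightarrow> (\<forall>i. S $ i \<in> {0, 1}) \<and> card {i. S $ i = 1} = k"

definition relaxed_k_hot :: "nat \<Rightarrow> real ^ 'n::finite \<Rightarrow> bool" where
  "relaxed_k_hot k a \<longleftrightarrow> (\<forall>i. 0 \<le> a $ i \<and> a $ i \<le> 1) \<and> (\<Sum>i\<in>UNIV. a $ i) = real k"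

definition wrs_prob :: "real ^ 'n::finite \<Rightarrow> 'n list \<Rightarrow> real" where
  "wrs_prob w is =
     (\<Prod>j<length is. w $ (is ! j) / ((\<Sum>i\<in>UNIV. w $ i) - (\<Sum>l<j. w $ (is ! l))))"

definition orderings :: "real ^ 'n::finite \<Rightarrow> 'n list set" where
  "orderings S = {is. distinct is \<and> sum_list (map one_hot is) = S}"

definition subset_prob :: "real ^ 'n::finite \<Rightarrow> real ^ 'n \<Rightarrow> real" where
  "subset_prob w S = (\<Sum>is\<in>orderings S. wrs_prob w is)"

text \<open>Only meaningful when \<open>r\<close> has pairwise distinct entries and \<open>k \<le> CARD('n)\<close>.\<close>

definition TopK :: "real ^ 'n::finite \<Rightarrow> nat \<Rightarrow> 'n list" where
  "TopK r k = (THE is. length is = k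
                 \<and> sorted_wrt (\<lambda>i j. r $ i > r $ j) is
                 \<and> (\<forall>i\<in>set is. \<forall>j. j \<notin> set is \<longrightarrow> r $ i > r $ j))"

definition topk_relaxation :: "(real ^ 'n::finite \<Rightarrow> nat \<Rightarrow> real \<Rightarrow> real ^ 'n) \<Rightarrow> bool" where
  "topk_relaxation RelaxedTopK \<longleftrightarrow>
     (\<forall>k. 1 \<le> k \<and> k \<le> CARD('n) \<longrightarrow>
        (\<forall>t>0. (\<lambda>r. RelaxedTopK r k t) differentiable_on UNIV) \<and>
        (\<forall>t>0. \<forall>r. relaxed_k_hot k (RelaxedTopK r k t)) \<and>
        (\<forall>r. inj (\<lambda>i. r $ i) \<longrightarrow>
           ((\<lambda>t. RelaxedTopK r k t) \<longlongrightarrow> (\<Sum>j<k. one_hot (TopK r k ! j))) (at_right 0)))"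

definition sampling_keys :: "real ^ 'n::finite \<Rightarrow> ('n \<Rightarrow> real) \<Rightarrow> real ^ 'n" where
  "sampling_keys w u = (\<chi> i. - ln (- ln (u i)) + ln (w $ i))"

definition relaxed_subset_sample ::
  "(real ^ 'n::finite \<Rightarrow> nat \<Rightarrow> real \<Rightarrow> real ^ 'n) \<Rightarrow> real ^ 'n \<Rightarrow> nat \<Rightarrow> real \<Rightarrow> ('n \<Rightarrow> real) \<Rightarrow> real ^ 'n"
  where "relaxed_subset_sample RelaxedTopK w k t u = RelaxedTopK (sampling_keys w u) k t"

end

theory Submission
  imports Defs
begin

text \<open>
  The key \<open>- ln (- ln u) + ln w\<close> is \<open>- ln X\<close> with \<open>X = - ln u / w\<close>, which is exponentially
  distributed with rate \<open>w\<close>. So the items in decreasing order of their keys are the items in the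
  order in which independent exponential clocks ring. The clock of item \<open>i\<close> rings first with
  probability \<open>w i / Z\<close>, and by memorylessness the race then restarts among the remaining items,
  which is sampling without replacement. Keys are almost surely pairwise distinct, so the
  relaxation converges to the indicator of the first \<open>k\<close> items, and summing over the orderings of
  a \<open>k\<close>-subset gives the subset distribution.
\<close>

section \<open>Races of clocks as events\<close>

text \<open>The set \<open>A\<close> of running clocks and the starting time \<open>t\<close> are
  parameters so that removing the first clock to ring leaves an event of the same kind.\<close>

definition race :: "real \<Rightarrow> 'i list \<Rightarrow> 'i set \<Rightarrow> ('i \<Rightarrow> real) \<Rightarrow> bool" where
  "race t is A x \<longleftrightarrow> (\<forall>i\<in>A. t < x i) \<and> sorted_wrt (\<lambda>i j. x i < x j) is
     \<and> (\<forall>i\<in>set is. \<forall>j\<in>A - set is. x i < x j)"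

lemma race_Nil: "race t [] A x \<longleftrightarrow> (\<forall>i\<in>A. t < x i)"
  by (simp add: race_def)

text \<open>The recursion behind the induction: the ringing time \<open>x i\<close> of the first
  clock becomes the starting time for the rest, whose bound by \<open>t\<close> follows by
  transitivity.\<close>

lemma race_Cons:
  assumes "i \<in> A" "i \<notin> set is" "set is \<subseteq> A"
  shows "race t (i # is) A x \<longleftrightarrow> t < x i \<and> race (x i) is (A - {i}) x"
proof
  assume "race t (i # is) A x"
  then show "t < x i \<and> race (x i) is (A - {i}) x"
    using assms unfolding race_def by auto
next
  assume R: "t < x i \<and> race (x i) is (A - {i}) x"
  have "t < x j" if "j \<in> A" for j
    using R that unfolding race_def by (cases "j = i") (auto intro: less_trans)
  then show "race t (i # is) A x"
    using R assms unfolding race_def by auto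
qed

lemma race_cong:
  assumes "\<And>i. i \<in> A \<Longrightarrow> x i = y i" "set is \<subseteq> A"
  shows "race t is A x \<longleftrightarrow> race t is A y"
proof -
  have "sorted_wrt (\<lambda>i j. x i < x j) is \<longleftrightarrow> sorted_wrt (\<lambda>i j. y i < y j) is"
    using assms by (auto simp: sorted_wrt_iff_nth_less subset_iff)
  then show ?thesis
    using assms by (auto simp: race_def subset_iff)
qed

lemma pred_race [measurable]:
  assumes "finite A" "set is \<subseteq> A" and [measurable]: "\<And>i. i \<in> A \<Longrightarrow> (\<lambda>\<omega>. x \<omega> i) \<in> borel_measurable N"
  shows "Measurable.pred N (\<lambda>\<omega>. race t is A (x \<omega>))"
proof -
  have [measurable]: "(\<lambda>\<omega>. x \<omega> (is ! a)) \<in> borel_measurable N" if "a < length is" for a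
    using assms that by (auto simp: subset_iff)
  \<comment> \<open>For a fixed list, sortedness is a finite conjunction of comparisons between
    coordinates, each of them measurable.\<close>
  have *: "(sorted_wrt (\<lambda>i j. x \<omega> i < x \<omega> j) is) \<longleftrightarrow>
      (\<forall>b\<in>{..<length is}. \<forall>a\<in>{..<b}. x \<omega> (is ! a) < x \<omega> (is ! b))" for \<omega>
    by (auto simp: sorted_wrt_iff_nth_less)
  have "Measurable.pred N (\<lambda>\<omega>. \<forall>b\<in>{..<length is}. \<forall>a\<in>{..<b}. x \<omega> (is ! a) < x \<omega> (is ! b))"
    by (intro pred_intros_finite) (auto intro!: borel_measurable_pred_less)
  moreover have "Measurable.pred N (\<lambda>\<omega>. \<forall>i\<in>A. t < x \<omega> i)"
    using assms(1) by (intro pred_intros_finite) (auto intro!: borel_measurable_pred_less)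
  moreover have "Measurable.pred N (\<lambda>\<omega>. \<forall>i\<in>set is. \<forall>j\<in>A - set is. x \<omega> i < x \<omega> j)"
    using assms(1,2) by (intro pred_intros_finite) (auto intro!: borel_measurable_pred_less assms(3))
  ultimately show ?thesis
    unfolding race_def * by (intro pred_intros_logic)
qed

section \<open>The probability of a race of exponential clocks\<close>

lemma emeasure_exponential_greaterThan:
  assumes "0 < l" "0 \<le> t"
  shows "emeasure (density lborel (exponential_density l)) {t<..} = ennreal (exp (- t * l))"
proof -
  interpret prob_space "density lborel (exponential_density l)"
    using assms(1) by (rule prob_space_exponential_density)
  have "distributed (density lborel (exponential_density l)) lborel (\<lambda>x. x) (exponential_density l)"
    using assms by (auto simp: distributed_def distr_id2)
  from exponential_distributedD_gt[OF this assms(2,1)] show ?thesis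
    by (simp add: emeasure_eq_measure greaterThan_def)
qed

text \<open>One clock of rate \<open>l\<close> rings at a time \<open>y > t\<close> while the
  others, of total rate \<open>c\<close>, stay silent up to \<open>y\<close>; \<open>C\<close>
  stands for the probability of the order of the rest.\<close>

lemma nn_integral_exponential_tail:
  fixes l c C t :: real
  assumes "0 < l" "0 \<le> c" "0 \<le> t" "0 \<le> C"
  shows "(\<integral>\<^sup>+y. indicator {t<..} y * ennreal (exp (- y * c) * C) \<partial>density lborel (exponential_density l))
    = ennreal (exp (- t * (l + c)) * (l / (l + c) * C))"
proof -
  have "(\<integral>\<^sup>+y. indicator {t<..} y * ennreal (exp (- y * c) * C) \<partial>density lborel (exponential_density l))
    = (\<integral>\<^sup>+y. ennreal (exponential_density l y) * (indicator {t<..} y * ennreal (exp (- y * c) * C)) \<partial>lborel)"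
    using assms by (subst nn_integral_density) auto
  also have "\<dots> = (\<integral>\<^sup>+y. ennreal (l / (l + c) * C) * (ennreal (exponential_density (l + c) y) * indicator {t<..} y) \<partial>lborel)"
  proof (intro nn_integral_cong)
    fix y :: real
    \<comment> \<open>The minimum of all clocks is exponential of rate \<open>l + c\<close>, and
      \<open>l / (l + c)\<close> is the chance that this clock attains it.\<close>
    have "exponential_density l y * (exp (- y * c) * C) = l / (l + c) * C * exponential_density (l + c) y"
      using assms by (auto simp: exponential_density_def exp_add[symmetric] algebra_simps divide_simps)
    then show "ennreal (exponential_density l y) * (indicator {t<..} y * ennreal (exp (- y * c) * C)) =
      ennreal (l / (l + c) * C) * (ennreal (exponential_density (l + c) y) * indicator {t<..} y)"
      using assms by (auto simp: ennreal_mult'[symmetric] split: split_indicator)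
  qed
  also have "\<dots> = ennreal (l / (l + c) * C) * emeasure (density lborel (exponential_density (l + c))) {t<..}"
    using assms by (subst nn_integral_cmult) (auto simp: emeasure_density)
  also have "\<dots> = ennreal (exp (- t * (l + c)) * (l / (l + c) * C))"
    using assms by (subst emeasure_exponential_greaterThan)
      (auto simp: ennreal_mult'[symmetric] mult.commute)
  finally show ?thesis .
qed

text \<open>Each denominator is the weight of the items not yet drawn: as the list is distinct, the
  subtracted sum runs over a subset of \<open>A\<close>. Nonnegativity allows passing between
  \<open>ennreal\<close> and real values.\<close>

lemma race_prod_nonneg:
  fixes w :: "'i \<Rightarrow> real"
  assumes "\<And>i. 0 < w i" "finite A" "distinct is" "set is \<subseteq> A"
  shows "0 \<le> (\<Prod>j<length is. w (is ! j) / (sum w A - (\<Sum>l<j. w (is ! l))))"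
proof (intro prod_nonneg ballI divide_nonneg_nonneg)
  fix j assume j: "j \<in> {..<length is}"
  have "(\<Sum>l<j. w (is ! l)) = sum w ((!) is ` {..<j})"
    using j assms(3) by (subst sum.reindex) (auto simp: inj_on_def nth_eq_iff_index_eq)
  also have "\<dots> \<le> sum w A"
    using assms j by (intro sum_mono2) (auto simp: less_imp_le)
  finally show "0 \<le> sum w A - (\<Sum>l<j. w (is ! l))" by simp
qed (use assms(1) less_imp_le in auto)

text \<open>The starting time \<open>t\<close> is what the induction on the list needs: once the first clock rings at
  time \<open>y\<close>, the remaining clocks form a race started at \<open>y\<close>.\<close>

lemma emeasure_race:
  fixes w :: "'i \<Rightarrow> real"
  assumes w: "\<And>i. 0 < w i" and "finite A" "distinct is" "set is \<subseteq> A" "0 \<le> t"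
  defines "E \<equiv> \<lambda>i. density lborel (exponential_density (w i))"
  shows "emeasure (PiM A E) {x \<in> space (PiM A E). race t is A x} =
    ennreal (exp (- t * sum w A) * (\<Prod>j<length is. w (is ! j) / (sum w A - (\<Sum>l<j. w (is ! l)))))"
  using assms(2-5)
proof (induction "is" arbitrary: A t)
  case Nil
  interpret product_sigma_finite E
    unfolding E_def product_sigma_finite_def
    using prob_space_exponential_density[OF w] prob_space_imp_sigma_finite by blast
  \<comment> \<open>With no order prescribed, the event is a box, so its measure is a product of
    tails.\<close>
  have "{x \<in> space (PiM A E). race t [] A x} = Pi\<^sub>E A (\<lambda>_. {t<..})"
    by (auto simp: race_Nil space_PiM E_def PiE_iff extensional_def)
  then have "emeasure (PiM A E) {x \<in> space (PiM A E). race t [] A x} = (\<Prod>i\<in>A. emeasure (E i) {t<..})"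
    using Nil by (simp only:) (rule emeasure_PiM, auto simp: E_def)
  also have "\<dots> = ennreal (\<Prod>i\<in>A. exp (- t * w i))"
    using Nil w by (simp add: E_def emeasure_exponential_greaterThan prod_ennreal)
  also have "(\<Prod>i\<in>A. exp (- t * w i)) = exp (- t * sum w A)"
    using Nil by (simp add: exp_sum sum_distrib_left sum_negf[symmetric])
  finally show ?case by simp
next
  case (Cons i "is")
  interpret product_sigma_finite E
    unfolding E_def product_sigma_finite_def
    using prob_space_exponential_density[OF w] prob_space_imp_sigma_finite by blast
  define B where "B = A - {i}"
  define P where "P = (\<Prod>j<length is. w (is ! j) / (sum w B - (\<Sum>l<j. w (is ! l))))"
  have A: "A = insert i B" "i \<notin> B" "finite B" "set is \<subseteq> B"
    using Cons.prems by (auto simp: B_def)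
  have sumA: "sum w A = w i + sum w B"
    using A by simp
  have [measurable]: "Measurable.pred (PiM A E) (\<lambda>x. race t (i # is) A x)"
    using Cons.prems by (intro pred_race) (auto simp: E_def)
  have P0: "0 \<le> P"
    unfolding P_def using A w Cons.prems by (intro race_prod_nonneg) auto
  have "emeasure (PiM A E) {x \<in> space (PiM A E). race t (i # is) A x} =
      (\<integral>\<^sup>+x. indicator {x \<in> space (PiM A E). race t (i # is) A x} x \<partial>PiM A E)"
    by (intro nn_integral_indicator[symmetric]) measurable
  also have "\<dots> = (\<integral>\<^sup>+x. indicator {x. race t (i # is) A x} x \<partial>PiM A E)"
    by (intro nn_integral_cong) (auto split: split_indicator)
  \<comment> \<open>Fubini with the ringing time \<open>y\<close> of the first clock
    \<open>i\<close> as the outer variable and the clocks of \<open>B\<close> inside.\<close>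
  also have "\<dots> = (\<integral>\<^sup>+y. (\<integral>\<^sup>+x. indicator {x. race t (i # is) A x} (x(i := y)) \<partial>PiM B E) \<partial>E i)"
    by (subst (1) A(1), rule product_nn_integral_insert_rev)
      (use A in \<open>simp_all add: A(1)[symmetric]\<close>)
  also have "\<dots> = (\<integral>\<^sup>+y. indicator {t<..} y * ennreal (exp (- y * sum w B) * P) \<partial>E i)"
  proof (intro nn_integral_cong)
    fix y
    have [measurable]: "Measurable.pred (PiM B E) (\<lambda>x. race y is B x)"
      using A by (intro pred_race) (auto simp: E_def)
    have "race y is B (x(i := y)) \<longleftrightarrow> race y is B x" for x
      using A by (intro race_cong) auto
    then have "race t (i # is) A (x(i := y)) \<longleftrightarrow> t < y \<and> race y is B x" for x
      using Cons.prems by (subst race_Cons) (auto simp: B_def)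
    then have "(\<integral>\<^sup>+x. indicator {x. race t (i # is) A x} (x(i := y)) \<partial>PiM B E) =
        (\<integral>\<^sup>+x. indicator {t<..} y * indicator {x \<in> space (PiM B E). race y is B x} x \<partial>PiM B E)"
      by (intro nn_integral_cong) (auto split: split_indicator)
    also have "\<dots> = indicator {t<..} y * emeasure (PiM B E) {x \<in> space (PiM B E). race y is B x}"
      by (subst nn_integral_cmult_indicator) measurable
    also have "\<dots> = indicator {t<..} y * ennreal (exp (- y * sum w B) * P)"
    \<comment> \<open>The induction hypothesis needs a nonnegative starting time, which
      \<open>0 \<le> t\<close> and \<open>t < y\<close> supply; otherwise both sides vanish.\<close>
    proof (cases "t < y")
      case True
      with Cons.IH[of B y] Cons.prems A show ?thesis by (simp add: P_def)
    qed simp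
    finally show "(\<integral>\<^sup>+x. indicator {x. race t (i # is) A x} (x(i := y)) \<partial>PiM B E) =
        indicator {t<..} y * ennreal (exp (- y * sum w B) * P)" .
  qed
  also have "\<dots> = ennreal (exp (- t * (w i + sum w B)) * (w i / (w i + sum w B) * P))"
    unfolding E_def using w P0 Cons.prems
    by (intro nn_integral_exponential_tail) (auto intro: sum_nonneg less_imp_le)
  \<comment> \<open>Index shift: the factor at \<open>0\<close> is \<open>w i / sum w A\<close>, and
    every later denominator loses \<open>w i\<close>, which turns \<open>sum w A\<close> into
    \<open>sum w B\<close>.\<close>
  also have "w i / (w i + sum w B) * P =
      (\<Prod>j<length (i # is). w ((i # is) ! j) / (sum w A - (\<Sum>l<j. w ((i # is) ! l))))"
    by (simp add: P_def sumA prod.lessThan_Suc_shift sum.lessThan_Suc_shift del: prod.lessThan_Suc sum.lessThan_Suc)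
  finally show ?case by (simp only: sumA)
qed

section \<open>Absence of ties\<close>

text \<open>By Fubini: once all coordinates except \<open>i\<close> are fixed, a tie forces
  coordinate \<open>i\<close> to hit the single point \<open>x j\<close>, a null set.\<close>

lemma (in product_sigma_finite) AE_PiM_neq:
  assumes "finite I" "i \<in> I" "j \<in> I" "i \<noteq> j"
    and [measurable]: "Measurable.pred (PiM I M) (\<lambda>x. x i = x j)"
    and null: "\<And>y. {y} \<in> null_sets (M i)"
  shows "AE x in PiM I M. x i \<noteq> x j"
proof -
  define J where "J = I - {i}"
  have J: "I = insert i J" "finite J" "i \<notin> J" "j \<in> J"
    using assms by (auto simp: J_def)
  have "emeasure (PiM I M) {x \<in> space (PiM I M). x i = x j} =
      (\<integral>\<^sup>+x. indicator {x \<in> space (PiM I M). x i = x j} x \<partial>PiM I M)"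
    by (intro nn_integral_indicator[symmetric]) measurable
  also have "\<dots> = (\<integral>\<^sup>+x. indicator {x. x i = x j} x \<partial>PiM I M)"
    by (intro nn_integral_cong) (auto split: split_indicator)
  also have "\<dots> = (\<integral>\<^sup>+x. (\<integral>\<^sup>+y. indicator {x. x i = x j} (x(i := y)) \<partial>M i) \<partial>PiM J M)"
    unfolding J(1) by (intro product_nn_integral_insert J) (measurable, simp add: J(1)[symmetric])
  also have "\<dots> = (\<integral>\<^sup>+x. (\<integral>\<^sup>+y. indicator {x j} y \<partial>M i) \<partial>PiM J M)"
    using assms(4) by (intro nn_integral_cong) (auto split: split_indicator)
  also have "\<dots> = 0"
    using null by (simp add: null_sets_def nn_integral_indicator)
  finally show ?thesis
    by (intro AE_I[where N = "{x \<in> space (PiM I M). x i = x j}"]) auto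
qed

section \<open>Characterisation of \<open>TopK\<close>\<close>

lemma distinct_if_sorted_wrt_greater:
  fixes f :: "'a \<Rightarrow> 'b::preorder"
  assumes "sorted_wrt (\<lambda>i j. f i > f j) xs"
  shows "distinct xs"
  using assms by (induction xs) auto

lemma sorted_wrt_greater_unique:
  fixes f :: "'a \<Rightarrow> real"
  assumes "sorted_wrt (\<lambda>i j. f i > f j) xs" "sorted_wrt (\<lambda>i j. f i > f j) ys"
    and "set xs = set ys" "inj f"
  shows "xs = ys"
proof -
  have "sorted_wrt (<) (map (\<lambda>i. - f i) xs)" "sorted_wrt (<) (map (\<lambda>i. - f i) ys)"
    using assms(1,2) by (simp_all add: sorted_wrt_map)
  then have "map (\<lambda>i. - f i) xs = map (\<lambda>i. - f i) ys"
    using assms(3) by (intro strict_sorted_equal) auto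
  then show ?thesis
    using assms(4) by (auto simp: inj_on_def inj_map_eq_map)
qed

text \<open>Existence and uniqueness turn the definite description into a usable predicate: the
  witness is the prefix of length \<open>k\<close> of all items sorted by decreasing entry.\<close>

lemma TopK_eq_iff:
  fixes r :: "real ^ 'n::finite"
  assumes "inj (\<lambda>i. r $ i)" "k \<le> CARD('n)"
  shows "TopK r k = is \<longleftrightarrow> length is = k \<and> sorted_wrt (\<lambda>i j. r $ i > r $ j) is
     \<and> (\<forall>i\<in>set is. \<forall>j. j \<notin> set is \<longrightarrow> r $ i > r $ j)"
    (is "_ \<longleftrightarrow> ?P is")
proof -
  have unique: "xs = ys" if P: "?P xs" "?P ys" for xs ys
  proof -
    have card: "card (set xs) = k" "card (set ys) = k"
      using P by (auto simp: distinct_card distinct_if_sorted_wrt_greater)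
    \<comment> \<open>If neither set contained the other, an item only in \<open>xs\<close> and an
      item only in \<open>ys\<close> would each have the larger entry. Nested sets of equal size
      then coincide.\<close>
    have "set xs \<subseteq> set ys \<or> set ys \<subseteq> set xs"
      using P by (meson less_asym subsetI)
    then have "set xs = set ys"
      using card card_subset_eq[of "set xs" "set ys"] card_subset_eq[of "set ys" "set xs"] by auto
    with P assms(1) show ?thesis
      using sorted_wrt_greater_unique[of "\<lambda>i. r $ i" xs ys] by blast
  qed
  obtain zs :: "'n list" where zs: "set zs = UNIV" "distinct zs"
    using finite_distinct_list[of "UNIV :: 'n set"] by auto
  define ys where "ys = sort_key (\<lambda>i. - r $ i) zs"
  have ys: "set ys = UNIV" "distinct ys" "length ys = CARD('n)" "sorted (map (\<lambda>i. - r $ i) ys)"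
    using zs distinct_card[of zs] by (auto simp: ys_def)
  have "distinct (map (\<lambda>i. - r $ i) ys)"
    using ys assms(1) by (auto simp: distinct_map inj_on_def)
  then have "sorted_wrt (<) (map (\<lambda>i. - r $ i) ys)"
    using ys(4) by (simp add: strict_sorted_iff)
  \<comment> \<open>Splitting the list at \<open>k\<close> gives both requirements at once: the
    prefix is sorted, and its entries beat all dropped ones.\<close>
  then have sorted: "sorted_wrt (\<lambda>i j. r $ i > r $ j) (take k ys @ drop k ys)"
    by (simp add: sorted_wrt_map)
  have "?P (take k ys)"
  proof (intro conjI ballI allI impI)
    show "length (take k ys) = k" using ys assms by simp
    show "sorted_wrt (\<lambda>i j. r $ i > r $ j) (take k ys)" using sorted by (simp only: sorted_wrt_append)
    fix i j assume i: "i \<in> set (take k ys)" and j: "j \<notin> set (take k ys)"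
    have "j \<in> set (take k ys @ drop k ys)" using ys by simp
    with j have "j \<in> set (drop k ys)" unfolding set_append by blast
    with sorted i show "r $ i > r $ j" by (auto simp only: sorted_wrt_append)
  qed
  then have "\<exists>!xs. ?P xs" using unique by blast
  from theI'[OF this] have "?P (TopK r k)" unfolding TopK_def .
  then show ?thesis using unique by blast
qed

section \<open>Orderings and \<open>k\<close>-hot vectors\<close>

lemma sum_list_one_hot:
  assumes "distinct is"
  shows "sum_list (map one_hot is) $ i = (if i \<in> set is then 1 else 0)"
  using assms by (induction "is") (auto simp: one_hot_def axis_def)

lemma k_hot_sum_list_one_hot:
  assumes "distinct is"
  shows "k_hot (length is) (sum_list (map one_hot is))"
  using assms by (simp add: k_hot_def sum_list_one_hot distinct_card)

text \<open>\<open>orderings\<close> does not mention \<open>k\<close>; the length is recovered by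
  counting the ones of the sum.\<close>

lemma length_orderings:
  assumes "k_hot k S" "is \<in> orderings S"
  shows "length is = k"
proof -
  from assms(2) have "distinct is" "S = sum_list (map one_hot is)" by (auto simp: orderings_def)
  with assms(1) k_hot_sum_list_one_hot[of "is"] show ?thesis by (simp add: k_hot_def)
qed

lemma finite_orderings: "finite (orderings S)"
proof (rule finite_subset)
  show "orderings S \<subseteq> {is. set is \<subseteq> UNIV \<and> distinct is}" by (auto simp: orderings_def)
  show "finite {is :: 'a list. set is \<subseteq> UNIV \<and> distinct is}"
    by (intro finite_subset_distinct) simp
qed

text \<open>A \<open>k\<close>-hot vector is the indicator of its support. Finiteness reduces
  measurability of \<open>S\<close> to its single values.\<close>

lemma finite_k_hot: "finite {s :: real ^ 'n::finite. k_hot k s}"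
proof (rule finite_subset)
  show "{s :: real ^ 'n. k_hot k s} \<subseteq> (\<lambda>A. \<chi> i. if i \<in> A then 1 else 0) ` UNIV"
  proof
    fix s :: "real ^ 'n" assume "s \<in> {s. k_hot k s}"
    then have "s = (\<chi> i. if i \<in> {i. s $ i = 1} then 1 else 0)"
      by (auto simp: k_hot_def vec_eq_iff)
    then show "s \<in> (\<lambda>A. \<chi> i. if i \<in> A then 1 else 0) ` UNIV" by blast
  qed
qed simp

section \<open>From uniform variables to clocks and keys\<close>

text \<open>Inverse transform sampling: \<open>- ln u / l \<le> a\<close> means
  \<open>exp (- a * l) \<le> u\<close>, which has probability \<open>1 - exp (- a * l)\<close>, the
  exponential distribution function.\<close>

lemma distr_uniform_exponential:
  assumes "prob_space M" and u [measurable]: "u \<in> borel_measurable M"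
    and U: "distr M borel u = uniform_measure lborel {0<..<1}" and l: "0 < l"
  shows "distr M borel (\<lambda>x. - ln (u x) / l) = density lborel (exponential_density l)"
    and "AE x in M. 0 < u x \<and> u x < 1"
proof -
  have "AE y in distr M borel u. y \<in> {0<..<1::real}"
    unfolding U by (intro AE_uniform_measureI) auto
  then show AE01: "AE x in M. 0 < u x \<and> u x < 1"
    by (subst (asm) AE_distr_iff) auto
  have "distributed M lborel (\<lambda>x. - ln (u x) / l) (exponential_density l)"
  proof (rule exponential_distributedI)
    fix a :: real assume a: "0 \<le> a"
    have "emeasure M {x \<in> space M. - ln (u x) / l \<le> a} = emeasure M {x \<in> space M. exp (- a * l) \<le> u x}"
    \<comment> \<open>The two events agree only almost surely, since inverting \<open>ln\<close>
      requires \<open>0 < u x\<close>.\<close>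
    proof (rule emeasure_eq_AE)
      show "AE x in M. x \<in> {x \<in> space M. - ln (u x) / l \<le> a} \<longleftrightarrow> x \<in> {x \<in> space M. exp (- a * l) \<le> u x}"
        using AE01
      proof eventually_elim
        case (elim x)
        have "- ln (u x) / l \<le> a \<longleftrightarrow> - a * l \<le> ln (u x)"
          using l by (auto simp: field_simps)
        also have "\<dots> \<longleftrightarrow> exp (- a * l) \<le> u x"
          using elim by (simp add: ln_ge_iff)
        finally show ?case by simp
      qed
    qed auto
    also have "\<dots> = emeasure (distr M borel u) {exp (- a * l)..}"
      by (subst emeasure_distr) (auto intro!: arg_cong[where f = "emeasure M"])
    also have "\<dots> = emeasure lborel ({0<..<1} \<inter> {exp (- a * l)..}) / emeasure lborel {0<..<1::real}"
      unfolding U by (rule emeasure_uniform_measure) auto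
    also have "{0<..<1} \<inter> {exp (- a * l)..} = {exp (- a * l)..<1}"
      by (auto intro: less_le_trans[OF exp_gt_zero])
    also have "emeasure lborel {exp (- a * l)..<1} / emeasure lborel {0<..<1::real} = 1 - ennreal (exp (- a * l))"
      using a l by (simp add: ennreal_minus ennreal_1[symmetric] divide_ennreal del: ennreal_1)
    finally show "emeasure M {x \<in> space M. - ln (u x) / l \<le> a} = 1 - ennreal (exp (- a * l))" .
  qed (use l in auto)
  then show "distr M borel (\<lambda>x. - ln (u x) / l) = density lborel (exponential_density l)"
    by (simp add: distributed_def cong: distr_cong)
qed

text \<open>Each key is \<open>- ln\<close> of a positive ringing time, and \<open>- ln\<close> is
  decreasing there: the larger key belongs to the earlier clock.\<close>

lemma sampling_keys_less_iff:
  fixes w :: "real ^ 'n::finite"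
  assumes "\<And>i. 0 < w $ i" "\<And>i. 0 < u i \<and> u i < 1"
  shows "sampling_keys w u $ j < sampling_keys w u $ i \<longleftrightarrow> - ln (u i) / w $ i < - ln (u j) / w $ j"
proof -
  have pos: "0 < - ln (u i) / w $ i" for i
    using assms by (simp add: divide_neg_pos)
  have "sampling_keys w u $ i = - ln (- ln (u i) / w $ i)" for i
    using assms(1)[of i] assms(2)[of i] ln_div[of "- ln (u i)" "w $ i"] by (simp add: sampling_keys_def)
  then show ?thesis
    using pos ln_less_cancel_iff[OF pos[of i] pos[of j]] by simp
qed

section \<open>Convergence and law of the limit\<close>

theorem proposition1:
  fixes M :: "'a measure"
    and k :: nat
    and w :: "real ^ 'n::finite"
    and RelaxedTopK :: "real ^ 'n \<Rightarrow> nat \<Rightarrow> real \<Rightarrow> real ^ 'n"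
    and u :: "'n \<Rightarrow> 'a \<Rightarrow> real"
  assumes "1 \<le> k" and "k \<le> CARD('n)"
    and "\<And>i. w $ i > 0"
    and "topk_relaxation RelaxedTopK"
    and "prob_space M"
    and "prob_space.indep_vars M (\<lambda>_. borel) u UNIV"
    and "\<And>i. distr M borel (u i) = uniform_measure lborel {0<..<1}"
  shows "\<exists>S. S \<in> measurable M (count_space {s :: real ^ 'n. k_hot k s}) \<and>
           (AE x in M. ((\<lambda>t. relaxed_subset_sample RelaxedTopK w k t (\<lambda>i. u i x)) \<longlongrightarrow> S x) (at_right 0)) \<and>
           (\<forall>s. k_hot k s \<longrightarrow> measure M {x \<in> space M. S x = s} = subset_prob w s)"
proof -
  note w = assms(3) and kn = assms(2)
  interpret prob_space M by fact
  have [measurable]: "u i \<in> borel_measurable M" for i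
    using assms(6) by (simp add: indep_vars_def)
  define X where "X = (\<lambda>i x. - ln (u i x) / w $ i)"
  define E where "E = (\<lambda>i. density lborel (exponential_density (w $ i)))"
  have [measurable]: "X i \<in> borel_measurable M" for i
    by (simp add: X_def)
  define keys where "keys = (\<lambda>x. sampling_keys w (\<lambda>i. u i x))"
  have [measurable]: "(\<lambda>x. keys x $ i) \<in> borel_measurable M" for i
    by (simp add: keys_def sampling_keys_def)
  interpret E: product_sigma_finite E
    unfolding E_def product_sigma_finite_def
    using prob_space_exponential_density[OF w] prob_space_imp_sigma_finite by blast
  have setsE [simp, measurable_cong]: "sets (E i) = sets borel" for i
    by (simp add: E_def)
  have sets_PiM_E [measurable_cong]: "sets (PiM UNIV E) = sets (PiM UNIV (\<lambda>_. borel))"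
    by (intro sets_PiM_cong) auto
  have distr_X: "distr M borel (X i) = E i" for i
    unfolding X_def E_def by (intro distr_uniform_exponential assms) auto
  have "indep_vars (\<lambda>_. borel) X UNIV"
    unfolding X_def by (intro indep_vars_compose2[OF assms(6)]) auto
  \<comment> \<open>Independence makes the joint law of the ringing times a product of exponential
    laws, so the race formula and the absence of ties carry over to \<open>M\<close>.\<close>
  then have joint: "distr M (PiM UNIV (\<lambda>_. borel)) (\<lambda>x i. X i x) = PiM UNIV E"
    by (subst (asm) indep_vars_iff_distr_eq_PiM) (auto simp: distr_X restrict_def)
  have [measurable]: "(\<lambda>x i. X i x) \<in> measurable M (PiM UNIV (\<lambda>_. borel))"
    by (intro measurable_PiM_single') (auto simp: space_PiM)

  have AE_u: "AE x in M. \<forall>i. 0 < u i x \<and> u i x < 1"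
    using distr_uniform_exponential(2)[OF assms(5) _ assms(7) w] by (simp add: AE_all_countable)
  have AE_X: "AE x in M. \<forall>i j. i \<noteq> j \<longrightarrow> X i x \<noteq> X j x"
  proof -
    have "AE x in M. X i x \<noteq> X j x" if "i \<noteq> j" for i j
    proof -
      have "AE y in PiM UNIV E. y i \<noteq> y j"
      proof (intro E.AE_PiM_neq that)
        fix y :: real
        have "AE x in lborel. x \<in> {y} \<longrightarrow> ennreal (exponential_density (w $ i) x) = 0"
          using AE_lborel_singleton[of y] by eventually_elim auto
        then show "{y} \<in> null_sets (E i)"
          unfolding E_def by (subst null_sets_density_iff) auto
        show "Measurable.pred (PiM UNIV E) (\<lambda>y. y i = y j)"
          by (subst measurable_cong_sets[OF sets_PiM_E refl])
            (auto simp: pred_def intro!: borel_measurable_eq)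
      qed auto
      then show ?thesis
        unfolding joint[symmetric] by (subst (asm) AE_distr_iff) (auto intro!: borel_measurable_neq)
    qed
    then have "AE x in M. \<forall>i\<in>UNIV. \<forall>j\<in>UNIV. i \<noteq> j \<longrightarrow> X i x \<noteq> X j x"
      by (intro AE_finite_allI) auto
    then show ?thesis by simp
  qed
  have AE_inj: "AE x in M. inj (\<lambda>i. keys x $ i)"
    using AE_u AE_X
  proof eventually_elim
    case (elim x)
    \<comment> \<open>Equal keys mean that neither ringing time is smaller, hence a tie, which
      \<open>AE_X\<close> excludes for \<open>i \<noteq> j\<close>.\<close>
    have "i = j" if "keys x $ i = keys x $ j" for i j
      using that elim(2) sampling_keys_less_iff[of w "\<lambda>i. u i x", OF w] elim(1)
      unfolding keys_def X_def by (metis less_irrefl linorder_neqE_linordered_idom)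
    then show ?case by (auto simp: inj_on_def)
  qed

  \<comment> \<open>A substitute for \<open>TopK (keys x) k = is\<close> that is visibly measurable,
    being a finite combination of comparisons.\<close>
  define top where "top = (\<lambda>is x. length is = k \<and> sorted_wrt (\<lambda>i j. keys x $ i > keys x $ j) is
     \<and> (\<forall>i\<in>set is. \<forall>j. j \<notin> set is \<longrightarrow> keys x $ i > keys x $ j))"
  have TopK_iff: "TopK (keys x) k = is \<longleftrightarrow> top is x" if "inj (\<lambda>i. keys x $ i)" for x "is"
    using TopK_eq_iff[OF that kn] by (simp add: top_def)
  have top_distinct: "distinct is" if "top is x" for "is" x
    using that by (auto simp: top_def intro: distinct_if_sorted_wrt_greater)
  \<comment> \<open>For \<open>u\<close> in the open unit interval all ringing times are positive,
    so the starting time \<open>0\<close> imposes nothing.\<close>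
  have top_race: "top is x \<longleftrightarrow> length is = k \<and> race 0 is UNIV (\<lambda>i. X i x)"
    if "\<forall>i. 0 < u i x \<and> u i x < 1" for "is" x
    using sampling_keys_less_iff[of w "\<lambda>i. u i x", OF w] that w
    by (auto simp: top_def race_def keys_def X_def divide_neg_pos)
  have [measurable]: "Measurable.pred M (top is)" for "is"
    unfolding top_def sorted_wrt_iff_nth_less by measurable
  have [measurable]: "Measurable.pred M (\<lambda>x. inj (\<lambda>i. keys x $ i))"
    unfolding inj_on_def by measurable

  obtain zs :: "'n list" where zs: "set zs = UNIV" "distinct zs"
    using finite_distinct_list[of "UNIV :: 'n set"] by auto
  \<comment> \<open>\<open>s0\<close> is an arbitrary value on the null set where keys coincide, since \<open>S\<close> must be
    \<open>k\<close>-hot everywhere.\<close>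
  define s0 :: "real ^ 'n" where "s0 = sum_list (map one_hot (take k zs))"
  have s0: "k_hot k s0"
    using k_hot_sum_list_one_hot[of "take k zs"] zs kn distinct_card[of zs] by (simp add: s0_def min_absorb2)
  define S where "S = (\<lambda>x. if inj (\<lambda>i. keys x $ i) then sum_list (map one_hot (TopK (keys x) k)) else s0)"
  have S_eq_iff: "S x = s \<longleftrightarrow> (\<exists>is\<in>orderings s. top is x)" if "inj (\<lambda>i. keys x $ i)" for x s
  proof
    assume "S x = s"
    with that have "sum_list (map one_hot (TopK (keys x) k)) = s" by (simp add: S_def)
    moreover have "top (TopK (keys x) k) x" using TopK_iff[OF that] by blast
    ultimately show "\<exists>is\<in>orderings s. top is x"
      using top_distinct by (auto simp: orderings_def)
  next
    assume "\<exists>is\<in>orderings s. top is x"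
    then obtain "is" where "is": "is \<in> orderings s" "top is x" by blast
    with TopK_iff[OF that] have "TopK (keys x) k = is" by blast
    with "is" that show "S x = s" by (simp add: S_def orderings_def)
  qed
  have pred_S: "Measurable.pred M (\<lambda>x. S x = s)" for s
  proof -
    \<comment> \<open>Splitting by injectivity of the keys leaves a finite union of the events
      \<open>top is\<close> and a constant case.\<close>
    have eq: "S x = s \<longleftrightarrow> (inj (\<lambda>i. keys x $ i) \<and> (\<exists>is\<in>orderings s. top is x)) \<or> (\<not> inj (\<lambda>i. keys x $ i) \<and> s0 = s)" for x
      using S_eq_iff[of x s] by (auto simp: S_def)
    show ?thesis
      unfolding eq using finite_orderings[of s] by measurable
  qed
  have S_hot: "k_hot k (S x)" for x
  proof (cases "inj (\<lambda>i. keys x $ i)")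
    case True
    then have top: "top (TopK (keys x) k) x" using TopK_iff by blast
    then have "length (TopK (keys x) k) = k" by (simp add: top_def)
    then show ?thesis
      using k_hot_sum_list_one_hot[OF top_distinct[OF top]] True by (simp add: S_def)
  qed (simp add: S_def s0)

  have "S \<in> measurable M (count_space {s. k_hot k s})"
    using pred_S S_hot
    by (subst measurable_count_space_eq2[OF finite_k_hot])
      (auto simp: pred_def vimage_def Int_def conj_commute)
  moreover have "AE x in M. ((\<lambda>t. relaxed_subset_sample RelaxedTopK w k t (\<lambda>i. u i x)) \<longlongrightarrow> S x) (at_right 0)"
    using AE_inj
  proof eventually_elim
    case (elim x)
    have "((\<lambda>t. RelaxedTopK (keys x) k t) \<longlongrightarrow> (\<Sum>j<k. one_hot (TopK (keys x) k ! j))) (at_right 0)"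
      using assms(1,2,4) elim unfolding topk_relaxation_def by blast
    moreover have "length (TopK (keys x) k) = k"
      using TopK_iff[of x] elim by (auto simp: top_def)
    \<comment> \<open>Since the list has length exactly \<open>k\<close>, the sum over
      \<open>j < k\<close> is the whole list sum that defines \<open>S x\<close>.\<close>
    then have "(\<Sum>j<k. one_hot (TopK (keys x) k ! j)) = S x"
      using elim by (simp add: S_def sum_list_sum_nth atLeast0LessThan)
    ultimately show ?case
      by (simp add: relaxed_subset_sample_def keys_def)
  qed
  moreover have "measure M {x \<in> space M. S x = s} = subset_prob w s" if s: "k_hot k s" for s
  proof -
    have race: "measure M {x \<in> space M. top is x} = wrs_prob w is" if "is": "is \<in> orderings s" for "is"
    proof -
      have len: "length is = k" and dist: "distinct is"
        using "is" length_orderings[OF s] by (auto simp: orderings_def)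
      have race_sets: "Measurable.pred (PiM UNIV (\<lambda>_. borel)) (race 0 is UNIV)"
        by (intro pred_race) auto
      have [measurable]: "Measurable.pred M (\<lambda>x. race 0 is UNIV (\<lambda>i. X i x))"
        by (intro pred_race) auto
      have "emeasure M {x \<in> space M. top is x} = emeasure M {x \<in> space M. race 0 is UNIV (\<lambda>i. X i x)}"
        by (rule emeasure_eq_AE) (use AE_u in \<open>auto simp: top_race len elim!: eventually_mono\<close>)
      also have "\<dots> = emeasure (PiM UNIV E) {x \<in> space (PiM UNIV E). race 0 is UNIV x}"
        unfolding joint[symmetric]
        using race_sets
        by (subst emeasure_distr) (auto intro!: arg_cong[where f = "emeasure M"] simp: space_PiM pred_def)
      also have "\<dots> = ennreal (wrs_prob w is)"
        unfolding E_def using w dist by (subst emeasure_race) (auto simp: wrs_prob_def)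
      finally show ?thesis
        using race_prod_nonneg[of "\<lambda>i. w $ i" UNIV "is"] w dist
        by (simp add: emeasure_eq_measure wrs_prob_def)
    qed
    \<comment> \<open>The injectivity conjunct makes the union disjoint, because then
      \<open>top is x\<close> determines \<open>is\<close> as \<open>TopK (keys x) k\<close>; it is
      dropped again almost surely after summing.\<close>
    have "measure M {x \<in> space M. S x = s} =
        measure M (\<Union>is\<in>orderings s. {x \<in> space M. inj (\<lambda>i. keys x $ i) \<and> top is x})"
    proof (rule measure_eq_AE)
      show "AE x in M. x \<in> {x \<in> space M. S x = s} \<longleftrightarrow>
          x \<in> (\<Union>is\<in>orderings s. {x \<in> space M. inj (\<lambda>i. keys x $ i) \<and> top is x})"
        using AE_inj by eventually_elim (auto simp: S_eq_iff)
    qed (use pred_S finite_orderings[of s] in \<open>auto simp: pred_def\<close>)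
    also have "\<dots> = (\<Sum>is\<in>orderings s. measure M {x \<in> space M. inj (\<lambda>i. keys x $ i) \<and> top is x})"
    proof (intro finite_measure_finite_Union finite_orderings)
      show "disjoint_family_on (\<lambda>is. {x \<in> space M. inj (\<lambda>i. keys x $ i) \<and> top is x}) (orderings s)"
        by (auto simp: disjoint_family_on_def simp flip: TopK_iff)
    qed auto
    also have "\<dots> = (\<Sum>is\<in>orderings s. measure M {x \<in> space M. top is x})"
      by (intro sum.cong measure_eq_AE) (use AE_inj in \<open>auto elim!: eventually_mono\<close>)
    also have "\<dots> = subset_prob w s"
      by (simp add: race subset_prob_def)
    finally show ?thesis .
  qed
  ultimately show ?thesis by blast
qed

end
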